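(* The ellipses are the only closed spacelike curves on the light cone $Q^2_+$ that evolve by homotheties along the curvature flow (CF) or the inverse curvature flow (ICF). They are ancient solutions that collapse into $0\in\mathbb{R}^3_1$ along the CF, and they evolve from $0\in\mathbb{R}^3_1$ along the ICF.
   Context: $\mathbb{R}^3_1$ is $\mathbb{R}^3$ with the Minkowski metric $\langle u,v\rangle=-u_1v_1+u_2v_2+u_3v_3$. The light cone is $Q^2=\{p\in\mathbb{R}^3_1\setminus\{0\}:\langle p,p\rangle=0\}$ and $Q^2_+=\{p\in Q^2:p_1>0\}$. For a (smooth) spacelike curve $X$ on $Q^2$ parametrized by arc length $s$, $T=X'$ is the unit tangent field, $Y(s)$ is the unique lightlike vector orthogonal to $T(s)$ with $\langle X(s),Y(s)\rangle=1$ (the associated curve), and the curvature $k$ is defined by $T'=kX-Y$. For an arbitrary parameter, $T,Y,k$ are those obtained via arc-length reparametrization. An ellipse of $Q^2_+$ is a spacelike curve of constant negative curvature (a planar conic section of the cone). A 1-parameter family of spacelike curves $\hat X:I\times J\to Q^2_+$, $J$ an interval containing $0$, with associated curves $\hat Y^t$ and curvatures $\hat k^t$, is a solution to the CF (resp. ICF, for non-vanishing curvatures) with initial condition $X$ if $\hat X^0=X$ and $\langle \frac{\partial}{\partial t}\hat X^t,\hat Y^t\rangle=\hat k^t$ (resp. $=-1/\hat k^t$). The curve $X$ evolves by homotheties along the flow if there is a solution of the form $\hat X(s,t)=f(t)X(s)$ with $f>0$ smooth, $f(0)=1$. An ancient solution is one defined for $t\in(-\infty,A)$ for some $A$. Collapsing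 into $0$ means $\hat X(s,t)\to0$ as $t$ tends to the final time $A$ of the maximal evolution; evolving from $0$ means $\hat X(s,t)\to 0$ as $t\to-\infty$. *)

theory Defs
  imports "HOL-Analysis.Analysis"
begin

section \<open>Minkowski space and its light cone\<close>

definition mink :: "real ^ 3 \<Rightarrow> real ^ 3 \<Rightarrow> real" where
  "mink u v = - (u $ 1 * v $ 1) + u $ 2 * v $ 2 + u $ 3 * v $ 3"

definition light_cone :: "(real ^ 3) set" where
  "light_cone = {p. p \<noteq> 0 \<and> mink p p = 0}"

definition future_cone :: "(real ^ 3) set" where
  "future_cone = {p \<in> light_cone. p $ 1 > 0}"


section \<open>Intervals and smoothness\<close>

text \<open>Parameter intervals may be open, half-open, closed or unbounded, but not degenerate.
  All derivatives are taken within the interval, i.e. they are one-sided at end points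
  that belong to it.\<close>

definition interval :: "real set \<Rightarrow> bool" where
  "interval I \<longleftrightarrow> is_interval I \<and> interior I \<noteq> {}"

definition smooth_on :: "real set \<Rightarrow> (real \<Rightarrow> 'a::real_normed_vector) \<Rightarrow> bool" where
  "smooth_on I f \<longleftrightarrow> (\<exists>F. F 0 = f \<and>
     (\<forall>n. \<forall>t\<in>I. (F n has_vector_derivative F (Suc n) t) (at t within I)))"

text \<open>Joint smoothness on \<open>I \<times> J\<close>: \<open>F m n\<close> is the \<open>m\<close>-th derivative in the first and
  \<open>n\<close>-th derivative in the second variable, and all of these exist and are jointly continuous.\<close>

definition smooth_family :: "real set \<Rightarrow> real set \<Rightarrow> (real \<Rightarrow> real \<Rightarrow> 'a::real_normed_vector) \<Rightarrow> bool" where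
  "smooth_family I J Xh \<longleftrightarrow> (\<exists>F. F 0 0 = Xh \<and>
     (\<forall>m n. continuous_on (I \<times> J) (\<lambda>(s, t). F m n s t) \<and>
       (\<forall>s\<in>I. \<forall>t\<in>J.
          ((\<lambda>u. F m n u t) has_vector_derivative F (Suc m) n s t) (at s within I) \<and>
          ((\<lambda>u. F m n s u) has_vector_derivative F m (Suc n) s t) (at t within J))))"


section \<open>Spacelike curves on the cone\<close>

definition spacelike_curve :: "real set \<Rightarrow> (real \<Rightarrow> real ^ 3) \<Rightarrow> bool" where
  "spacelike_curve I X \<longleftrightarrow> interval I \<and> smooth_on I X \<and>
     (\<forall>u\<in>I. X u \<in> future_cone \<and>
        mink (vector_derivative X (at u within I)) (vector_derivative X (at u within I)) > 0)"

definition speed :: "real set \<Rightarrow> (real \<Rightarrow> real ^ 3) \<Rightarrow> real \<Rightarrow> real" where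
  "speed I X u =
     sqrt (mink (vector_derivative X (at u within I)) (vector_derivative X (at u within I)))"

definition arc_length_parametrized :: "real set \<Rightarrow> (real \<Rightarrow> real ^ 3) \<Rightarrow> bool" where
  "arc_length_parametrized I X \<longleftrightarrow> (\<forall>u\<in>I. speed I X u = 1)"

text \<open>The derivative of a field \<open>V\<close> along \<open>X\<close> with respect to the arc length \<open>s\<close> of \<open>X\<close>,
  where \<open>ds/du\<close> is the speed of \<open>X\<close>. For an arc-length parametrized curve this is the ordinary
  derivative. The lemmas \<open>tangent_reparam\<close>, \<open>associated_reparam\<close> and \<open>curvature_reparam\<close> below
  show that the resulting objects for a curve in an arbitrary parameter are those of
  its arc-length reparametrization.\<close>

definition arc_deriv ::
    "real set \<Rightarrow> (real \<Rightarrow> real ^ 3) \<Rightarrow> (real \<Rightarrow> real ^ 3) \<Rightarrow> real \<Rightarrow> real ^ 3" where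
  "arc_deriv I X V u = (1 / speed I X u) *\<^sub>R vector_derivative V (at u within I)"

definition tangent :: "real set \<Rightarrow> (real \<Rightarrow> real ^ 3) \<Rightarrow> real \<Rightarrow> real ^ 3" where
  "tangent I X = arc_deriv I X X"

definition associated :: "real set \<Rightarrow> (real \<Rightarrow> real ^ 3) \<Rightarrow> real \<Rightarrow> real ^ 3" where
  "associated I X u = (THE y. y \<in> light_cone \<and> mink y (tangent I X u) = 0 \<and> mink (X u) y = 1)"

definition curvature :: "real set \<Rightarrow> (real \<Rightarrow> real ^ 3) \<Rightarrow> real \<Rightarrow> real" where
  "curvature I X u =
     (THE k. arc_deriv I X (tangent I X) u = k *\<^sub>R X u - associated I X u)"

definition ellipse :: "real set \<Rightarrow> (real \<Rightarrow> real ^ 3) \<Rightarrow> bool" where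
  "ellipse I X \<longleftrightarrow> spacelike_curve I X \<and> (\<exists>c<0. \<forall>u\<in>I. curvature I X u = c)"

definition closed_spacelike_curve :: "(real \<Rightarrow> real ^ 3) \<Rightarrow> bool" where
  "closed_spacelike_curve X \<longleftrightarrow> spacelike_curve UNIV X \<and> (\<exists>L>0. \<forall>u. X (u + L) = X u)"


section \<open>The flows\<close>

text \<open>A family is a function of the curve parameter \<open>s \<in> I\<close> and the time \<open>t \<in> J\<close>, in this order.\<close>

definition spacelike_family :: "real set \<Rightarrow> real set \<Rightarrow> (real \<Rightarrow> real \<Rightarrow> real ^ 3) \<Rightarrow> bool" where
  "spacelike_family I J Xh \<longleftrightarrow> interval J \<and> 0 \<in> J \<and> smooth_family I J Xh \<and>
     (\<forall>t\<in>J. spacelike_curve I (\<lambda>s. Xh s t))"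

definition normal_speed :: "real set \<Rightarrow> real set \<Rightarrow> (real \<Rightarrow> real \<Rightarrow> real ^ 3) \<Rightarrow> real \<Rightarrow> real \<Rightarrow> real" where
  "normal_speed I J Xh s t =
     mink (vector_derivative (\<lambda>r. Xh s r) (at t within J)) (associated I (\<lambda>r. Xh r t) s)"

definition CF_solution ::
    "real set \<Rightarrow> real set \<Rightarrow> (real \<Rightarrow> real ^ 3) \<Rightarrow> (real \<Rightarrow> real \<Rightarrow> real ^ 3) \<Rightarrow> bool" where
  "CF_solution I J X Xh \<longleftrightarrow> spacelike_family I J Xh \<and> (\<forall>s\<in>I. Xh s 0 = X s) \<and>
     (\<forall>s\<in>I. \<forall>t\<in>J. normal_speed I J Xh s t = curvature I (\<lambda>r. Xh r t) s)"

definition ICF_solution ::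
    "real set \<Rightarrow> real set \<Rightarrow> (real \<Rightarrow> real ^ 3) \<Rightarrow> (real \<Rightarrow> real \<Rightarrow> real ^ 3) \<Rightarrow> bool" where
  "ICF_solution I J X Xh \<longleftrightarrow> spacelike_family I J Xh \<and> (\<forall>s\<in>I. Xh s 0 = X s) \<and>
     (\<forall>s\<in>I. \<forall>t\<in>J. curvature I (\<lambda>r. Xh r t) s \<noteq> 0 \<and>
        normal_speed I J Xh s t = - 1 / curvature I (\<lambda>r. Xh r t) s)"

text \<open>The following notions are meant for \<open>sol = CF_solution\<close> and \<open>sol = ICF_solution\<close>.\<close>

type_synonym flow =
  "real set \<Rightarrow> real set \<Rightarrow> (real \<Rightarrow> real ^ 3) \<Rightarrow> (real \<Rightarrow> real \<Rightarrow> real ^ 3) \<Rightarrow> bool"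

definition homothetic_solution ::
    "flow \<Rightarrow> real set \<Rightarrow> real set \<Rightarrow> (real \<Rightarrow> real ^ 3) \<Rightarrow> (real \<Rightarrow> real) \<Rightarrow> bool" where
  "homothetic_solution sol I J X f \<longleftrightarrow>
     smooth_on J f \<and> (\<forall>t\<in>J. f t > 0) \<and> f 0 = 1 \<and> sol I J X (\<lambda>s t. f t *\<^sub>R X s)"

definition evolves_by_homotheties :: "flow \<Rightarrow> real set \<Rightarrow> (real \<Rightarrow> real ^ 3) \<Rightarrow> bool" where
  "evolves_by_homotheties sol I X \<longleftrightarrow> (\<exists>J f. homothetic_solution sol I J X f)"

text \<open>A solution is maximal if no solution whatsoever (homothetic or not) extends it to a larger
  time interval.\<close>

definition maximal_solution ::
    "flow \<Rightarrow> real set \<Rightarrow> real set \<Rightarrow> (real \<Rightarrow> real ^ 3) \<Rightarrow> (real \<Rightarrow> real \<Rightarrow> real ^ 3) \<Rightarrow> bool" where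
  "maximal_solution sol I J X Xh \<longleftrightarrow> sol I J X Xh \<and>
     (\<forall>J' Xh'. sol I J' X Xh' \<and> J \<subseteq> J' \<and> (\<forall>s\<in>I. \<forall>t\<in>J. Xh' s t = Xh s t) \<longrightarrow> J' = J)"

definition maximal_homothetic_evolution ::
    "flow \<Rightarrow> real set \<Rightarrow> real set \<Rightarrow> (real \<Rightarrow> real ^ 3) \<Rightarrow> (real \<Rightarrow> real) \<Rightarrow> bool" where
  "maximal_homothetic_evolution sol I J X f \<longleftrightarrow>
     homothetic_solution sol I J X f \<and> maximal_solution sol I J X (\<lambda>s t. f t *\<^sub>R X s)"

definition ancient :: "real set \<Rightarrow> bool" where
  "ancient J \<longleftrightarrow> (\<exists>A. J = {..<A})"

definition collapses_into_0 :: "real set \<Rightarrow> real set \<Rightarrow> (real \<Rightarrow> real \<Rightarrow> real ^ 3) \<Rightarrow> bool" where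
  "collapses_into_0 I J Xh \<longleftrightarrow>
     bdd_above J \<and> (\<forall>s\<in>I. ((\<lambda>t. Xh s t) \<longlongrightarrow> 0) (at (Sup J) within J))"

definition evolves_from_0 :: "real set \<Rightarrow> (real \<Rightarrow> real \<Rightarrow> real ^ 3) \<Rightarrow> bool" where
  "evolves_from_0 I Xh \<longleftrightarrow> (\<forall>s\<in>I. ((\<lambda>t. Xh s t) \<longlongrightarrow> 0) at_bot)"


section \<open>Arc-length reparametrization\<close>

lemma interval_at_within_neq_bot:
  assumes "interval I" "u \<in> I"
  shows "at u within I \<noteq> bot"
proof -
  have "connected I" "is_interval I"
    using assms(1) by (auto simp: interval_def is_interval_connected)
  moreover have "I \<noteq> {u}"
    using assms(1) by (auto simp: interval_def)
  ultimately show ?thesis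
    using assms(2) connected_imp_perfect[of I u] by (auto simp: trivial_limit_within)
qed

locale arc_length_reparam =
  fixes I L :: "real set" and X Z :: "real \<Rightarrow> real ^ 3" and \<sigma> \<sigma>' :: "real \<Rightarrow> real"
  assumes intervals: "interval I" "interval L"
    and image: "\<sigma> ` I = L"
    and deriv: "\<And>u. u \<in> I \<Longrightarrow> (\<sigma> has_vector_derivative \<sigma>' u) (at u within I)"
    and pos: "\<And>u. u \<in> I \<Longrightarrow> \<sigma>' u > 0"
    and reparam: "\<And>u. u \<in> I \<Longrightarrow> X u = Z (\<sigma> u)"
    and smooth: "smooth_on L Z"
    and unit_speed: "arc_length_parametrized L Z"
begin

lemma vector_derivative_comp:
  assumes "u \<in> I" "(W has_vector_derivative w) (at (\<sigma> u) within L)"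
    and "\<And>v. v \<in> I \<Longrightarrow> V v = W (\<sigma> v)"
  shows "vector_derivative V (at u within I) = \<sigma>' u *\<^sub>R w"
proof -
  have "((W \<circ> \<sigma>) has_vector_derivative \<sigma>' u *\<^sub>R w) (at u within I)"
    using vector_diff_chain_within[OF deriv[OF assms(1)]] assms(2) image by blast
  hence "(V has_vector_derivative \<sigma>' u *\<^sub>R w) (at u within I)"
    by (rule has_vector_derivative_transform[OF assms(1), rotated]) (simp add: assms(3))
  thus ?thesis
    by (rule vector_derivative_within[OF interval_at_within_neq_bot[OF intervals(1) assms(1)]])
qed

lemma derivatives:
  obtains D D2 where
    "\<And>s. s \<in> L \<Longrightarrow> (Z has_vector_derivative D s) (at s within L)"
    "\<And>s. s \<in> L \<Longrightarrow> (D has_vector_derivative D2 s) (at s within L)"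
    "\<And>s. s \<in> L \<Longrightarrow> mink (D s) (D s) = 1"
    "\<And>s. s \<in> L \<Longrightarrow> vector_derivative Z (at s within L) = D s"
proof -
  obtain F where F: "F 0 = Z"
      "\<And>n s. s \<in> L \<Longrightarrow> (F n has_vector_derivative F (Suc n) s) (at s within L)"
    using smooth by (auto simp: smooth_on_def)
  have *: "vector_derivative Z (at s within L) = F 1 s" if "s \<in> L" for s
    using vector_derivative_within[OF interval_at_within_neq_bot[OF intervals(2) that] F(2)[OF that, of 0]]
    by (simp add: F(1))
  show thesis
  proof (rule that[of "F 1" "F 2"])
    show "(Z has_vector_derivative F 1 s) (at s within L)" if "s \<in> L" for s
      using F(2)[OF that, of 0] by (simp add: F(1))
    show "(F 1 has_vector_derivative F 2 s) (at s within L)" if "s \<in> L" for s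
      using F(2)[OF that, of 1] by (simp add: numeral_2_eq_2)
    show "mink (F 1 s) (F 1 s) = 1" if "s \<in> L" for s
      using unit_speed that by (simp add: arc_length_parametrized_def speed_def *)
  qed (use * in auto)
qed

lemma speed_reparam: "u \<in> I \<Longrightarrow> speed I X u = \<sigma>' u"
proof -
  assume u: "u \<in> I"
  obtain D D2 where D: "\<And>s. s \<in> L \<Longrightarrow> (Z has_vector_derivative D s) (at s within L)"
    "\<And>s. s \<in> L \<Longrightarrow> mink (D s) (D s) = 1" using derivatives by metis
  have s: "\<sigma> u \<in> L" using u image by auto
  have "mink (c *\<^sub>R v) (c *\<^sub>R v) = c\<^sup>2 * mink v v" for c v
    by (simp add: mink_def power2_eq_square algebra_simps)
  thus ?thesis
    using D[OF s] pos[OF u] vector_derivative_comp[OF u D(1)[OF s] reparam]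
    by (simp add: speed_def)
qed

lemma tangent_reparam:
  assumes u: "u \<in> I"
  shows "tangent I X u = vector_derivative Z (at (\<sigma> u) within L)"
    and "tangent L Z (\<sigma> u) = vector_derivative Z (at (\<sigma> u) within L)"
proof -
  have s: "\<sigma> u \<in> L" using u image by auto
  obtain D D2 where D: "\<And>s. s \<in> L \<Longrightarrow> (Z has_vector_derivative D s) (at s within L)"
    "\<And>s. s \<in> L \<Longrightarrow> vector_derivative Z (at s within L) = D s" using derivatives by metis
  show "tangent I X u = vector_derivative Z (at (\<sigma> u) within L)"
    using pos[OF u] vector_derivative_comp[OF u D(1)[OF s] reparam] D(2)[OF s] speed_reparam[OF u]
    by (simp add: tangent_def arc_deriv_def)
  show "tangent L Z (\<sigma> u) = vector_derivative Z (at (\<sigma> u) within L)"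
    using unit_speed s by (simp add: tangent_def arc_deriv_def arc_length_parametrized_def)
qed

lemma associated_reparam: "u \<in> I \<Longrightarrow> associated I X u = associated L Z (\<sigma> u)"
  by (simp add: associated_def tangent_reparam reparam)

lemma curvature_reparam:
  assumes u: "u \<in> I"
  shows "curvature I X u = curvature L Z (\<sigma> u)"
proof -
  have s: "\<sigma> u \<in> L" using u image by auto
  obtain D D2 where D: "\<And>s. s \<in> L \<Longrightarrow> (D has_vector_derivative D2 s) (at s within L)"
    "\<And>s. s \<in> L \<Longrightarrow> vector_derivative Z (at s within L) = D s" using derivatives by metis
  have T: "tangent L Z v = D v" if "v \<in> L" for v
    using that image D(2) tangent_reparam(2) by auto
  have T': "(tangent L Z has_vector_derivative D2 (\<sigma> u)) (at (\<sigma> u) within L)"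
    by (rule has_vector_derivative_transform[OF s _ D(1)[OF s]]) (simp add: T)
  have "arc_deriv I X (tangent I X) u = D2 (\<sigma> u)"
    using pos[OF u] vector_derivative_comp[OF u T'] tangent_reparam speed_reparam[OF u]
    by (simp add: arc_deriv_def)
  moreover have "arc_deriv L Z (tangent L Z) (\<sigma> u) = D2 (\<sigma> u)"
    using unit_speed s
      vector_derivative_within[OF interval_at_within_neq_bot[OF intervals(2) s] T']
    by (simp add: arc_deriv_def arc_length_parametrized_def)
  ultimately show ?thesis
    by (simp add: curvature_def associated_reparam[OF u] reparam[OF u])
qed

end

end

theory Submission
  imports Defs
begin

text \<open>The homothety by \<open>\<lambda>\<close> turns \<open>Y\<close> into \<open>Y / \<lambda>\<close> and \<open>k\<close> into \<open>k / \<lambda>\<^sup>2\<close>, so for \<open>f(t) X(s)\<close> the CF is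
  \<open>f f' = k\<close> and the ICF is \<open>f' = - f\<^sup>3 / k\<close>; in particular \<open>k\<close> is constant. It is negative on a
  closed curve, since otherwise the time component of \<open>T\<close> would be strictly monotone.
  Conversely the equations have the solutions \<open>f = (1 + 2 k t) powr (1 / 2)\<close> and
  \<open>f = (1 + 2 t / k) powr (- 1 / 2)\<close>, which live on a half-line \<open>t < A\<close> when \<open>k < 0\<close>. No family
  on the cone extends them to \<open>A\<close>, because there \<open>f\<close> tends to \<open>0\<close> or to infinity.\<close>

section \<open>Null frames in Minkowski space\<close>

text \<open>Boundedness yields the product rule \<open>mink.has_vector_derivative\<close>, by which
  constant inner products of the moving frame are differentiated later.\<close>

interpretation mink: bounded_bilinear mink
proof
  show "\<exists>K. \<forall>a b. norm (mink a b) \<le> norm a * norm b * K"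
  proof (intro exI allI)
    fix a b :: "real ^ 3"
    have *: "\<bar>a $ i * b $ i\<bar> \<le> norm a * norm b" for i
      by (simp add: abs_mult mult_mono component_le_norm_cart)
    show "norm (mink a b) \<le> norm a * norm b * 3"
      using *[of 1] *[of 2] *[of 3] by (simp add: mink_def abs_le_iff)
  qed
qed (auto simp: mink_def algebra_simps)

lemma mink_commute: "mink u v = mink v u"
  by (simp add: mink_def)

text \<open>The planar part of a null vector is as long as its time component in absolute value. If
  \<open>y\<close> did not point to the past, Cauchy-Schwarz in the plane would give
  \<open>mink x y \<le> 0\<close>.\<close>

lemma mink_neg_of_future:
  assumes "x \<in> future_cone" "y \<in> light_cone" "mink x y > 0"
  shows "y $ 1 < 0"
proof (rule ccontr)
  assume neg: "\<not> y $ 1 < 0"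
  have x: "x $ 1 > 0" "(x $ 1)\<^sup>2 = (x $ 2)\<^sup>2 + (x $ 3)\<^sup>2"
    and y: "(y $ 1)\<^sup>2 = (y $ 2)\<^sup>2 + (y $ 3)\<^sup>2"
    using assms by (auto simp: future_cone_def light_cone_def mink_def power2_eq_square)
  \<comment> \<open>Lagrange's identity for the planar parts of \<open>x\<close> and
    \<open>y\<close>.\<close>
  have "(x $ 1 * y $ 1)\<^sup>2 - (x $ 2 * y $ 2 + x $ 3 * y $ 3)\<^sup>2 = (x $ 2 * y $ 3 - x $ 3 * y $ 2)\<^sup>2"
    unfolding power_mult_distrib x y by (simp add: power2_eq_square algebra_simps)
  hence "(x $ 2 * y $ 2 + x $ 3 * y $ 3)\<^sup>2 \<le> (x $ 1 * y $ 1)\<^sup>2"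
    by (smt (verit) zero_le_power2)
  moreover have "0 \<le> x $ 1 * y $ 1"
    using neg x(1) by simp
  ultimately have "x $ 2 * y $ 2 + x $ 3 * y $ 3 \<le> x $ 1 * y $ 1"
    by (rule power2_le_imp_le)
  thus False
    using assms(3) by (simp add: mink_def)
qed

text \<open>The assumed products say \<open>A ** B = mat 1\<close>, where the rows of
  \<open>A\<close> are the frame and the columns of \<open>B\<close> its dual frame for the metric.
  A right inverse of a square matrix is also a left inverse, and \<open>B ** A = mat 1\<close> is
  the expansion.\<close>

lemma null_frame_expansion:
  fixes x t y v :: "real ^ 3"
  assumes "mink x x = 0" "mink y y = 0" "mink x t = 0" "mink y t = 0" "mink t t = 1" "mink x y = 1"
  shows "v = mink v y *\<^sub>R x + mink v t *\<^sub>R t + mink v x *\<^sub>R y"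
proof -
  define \<eta> :: "3 \<Rightarrow> real" where "\<eta> i = (if i = 1 then - 1 else 1)" for i
  define A :: "real ^ 3 ^ 3" where "A = vector [x, t, y]"
  define B :: "real ^ 3 ^ 3" where "B = (\<chi> i. vector [\<eta> i * y $ i, \<eta> i * t $ i, \<eta> i * x $ i])"
  have "A ** B = mat 1"
    using assms
    by (simp add: vec_eq_iff forall_3 matrix_matrix_mult_def mat_def A_def B_def \<eta>_def sum_3
        mink_def algebra_simps)
  hence "B ** A = mat 1"
    by (simp add: matrix_left_right_inverse)
  hence *: "v v* (B ** A) = v"
    by simp
  show ?thesis
    by (subst *[symmetric])
      (simp add: vec_eq_iff forall_3 vector_matrix_mult_def matrix_matrix_mult_def
        A_def B_def \<eta>_def sum_3 mink_def algebra_simps)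
qed

text \<open>Reflecting the spatial part of \<open>x\<close> and rescaling gives a null vector
  \<open>y0\<close> with \<open>mink x y0 = 1\<close>. A null rotation fixing \<open>x\<close> then
  removes its product \<open>\<mu>\<close> with \<open>t\<close> and preserves the other two
  relations.\<close>

lemma associated_vector_exists:
  assumes "x \<in> future_cone" "mink x t = 0" "mink t t = 1"
  shows "\<exists>y. y \<in> light_cone \<and> mink y t = 0 \<and> mink x y = 1"
proof -
  have x: "x $ 1 > 0" "mink x x = 0"
    using assms by (auto simp: future_cone_def light_cone_def)
  define \<mu> where "\<mu> = t $ 1 / x $ 1"
  define y0 :: "real ^ 3" where "y0 = (-1 / (2 * (x $ 1)\<^sup>2)) *\<^sub>R (vector [x $ 1, - x $ 2, - x $ 3])"
  define y where "y = y0 + (\<mu>\<^sup>2 / 2) *\<^sub>R x - \<mu> *\<^sub>R t"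
  have "mink x (vector [x $ 1, - x $ 2, - x $ 3]) = - 2 * (x $ 1)\<^sup>2"
    "mink t (vector [x $ 1, - x $ 2, - x $ 3]) = - 2 * (x $ 1 * t $ 1)"
    "mink (vector [x $ 1, - x $ 2, - x $ 3]) (vector [x $ 1, - x $ 2, - x $ 3]) = (0::real)"
    using x(2) assms(2) by (simp_all add: mink_def power2_eq_square mult.commute)
  hence y0: "mink x y0 = 1" "mink t y0 = \<mu>" "mink y0 y0 = 0"
    using x(1) by (simp_all add: y0_def mink.minus_left mink.minus_right mink.scaleR_left mink.scaleR_right \<mu>_def power2_eq_square)
  have "mink y y = 0" "mink y t = 0" "mink x y = 1"
    using x(2) assms(2,3) y0
    by (simp_all add: y_def mink.add_left mink.add_right mink.diff_left mink.diff_right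
        mink.scaleR_left mink.scaleR_right mink_commute[of y0 x] mink_commute[of t x] mink_commute[of y0 t] power2_eq_square)
  moreover from this(3) have "y \<noteq> 0"
    by (auto simp: mink.zero_right)
  ultimately show ?thesis
    by (auto simp: light_cone_def)
qed

text \<open>In the frame \<open>x\<close>, \<open>t\<close>, \<open>y\<close> the vector
  \<open>z\<close> reads \<open>a *\<^sub>R x + y\<close>, and \<open>mink z z = 2 * a\<close>
  forces \<open>a = 0\<close>.\<close>

lemma associated_vector_unique:
  assumes "x \<in> future_cone" "mink x t = 0" "mink t t = 1"
    and "y \<in> light_cone" "mink y t = 0" "mink x y = 1"
    and "z \<in> light_cone" "mink z t = 0" "mink x z = 1"
  shows "z = y"
proof -
  have "z = mink z y *\<^sub>R x + mink z t *\<^sub>R t + mink z x *\<^sub>R y"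
    using assms by (intro null_frame_expansion) (auto simp: future_cone_def light_cone_def)
  hence z: "z = mink z y *\<^sub>R x + y"
    using assms by (simp add: mink_commute[of z x])
  have "mink z z = mink (mink z y *\<^sub>R x + y) (mink z y *\<^sub>R x + y)"
    using z by simp
  also have "\<dots> = 2 * mink z y"
    using assms
    by (simp add: light_cone_def future_cone_def mink.add_left mink.add_right mink.scaleR_left
        mink.scaleR_right mink_commute[of y x])
  finally show ?thesis
    using z assms(7) by (simp add: light_cone_def)
qed

section \<open>Frenet equations and homotheties\<close>

lemma smooth_on_derivatives:
  assumes "smooth_on I f"
  obtains F where "F 0 = f"
    "\<And>n t. t \<in> I \<Longrightarrow> (F n has_vector_derivative F (Suc n) t) (at t within I)"
  using assms by (auto simp: smooth_on_def)

lemma smooth_on_has_vector_derivative: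
  assumes "interval I" "smooth_on I f" "t \<in> I"
  shows "(f has_vector_derivative vector_derivative f (at t within I)) (at t within I)"
proof -
  obtain F where F: "F 0 = f" "\<And>n t. t \<in> I \<Longrightarrow> (F n has_vector_derivative F (Suc n) t) (at t within I)"
    using smooth_on_derivatives[OF assms(2)] by metis
  show ?thesis
    using F(2)[OF assms(3), of 0]
      vector_derivative_within[OF interval_at_within_neq_bot[OF assms(1,3)] F(2)[OF assms(3), of 0]]
    by (simp add: F(1))
qed

text \<open>Applied with constant \<open>g\<close>, it turns a conserved inner product into a linear
  relation between derivatives.\<close>

lemma has_vector_derivative_unique_interval:
  assumes "interval I" "u \<in> I" "(f has_vector_derivative a) (at u within I)"
    "(g has_vector_derivative b) (at u within I)" "\<And>v. v \<in> I \<Longrightarrow> f v = g v"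
  shows "a = b"
proof -
  have "(f has_vector_derivative b) (at u within I)"
    by (rule has_vector_derivative_transform[OF assms(2) _ assms(4)]) (simp add: assms(5))
  thus ?thesis
    using assms(3) vector_derivative_within[OF interval_at_within_neq_bot[OF assms(1,2)]] by metis
qed

locale spacelike =
  fixes I :: "real set" and X :: "real \<Rightarrow> real ^ 3"
  assumes curve: "spacelike_curve I X"
begin

abbreviation "T \<equiv> tangent I X"
abbreviation "Y \<equiv> associated I X"
abbreviation "k \<equiv> curvature I X"
abbreviation "v \<equiv> speed I X"

lemma interval: "interval I" and smooth: "smooth_on I X"
  using curve by (auto simp: spacelike_curve_def)

lemma future: "u \<in> I \<Longrightarrow> X u \<in> future_cone"
  using curve by (auto simp: spacelike_curve_def)

lemma null: "u \<in> I \<Longrightarrow> mink (X u) (X u) = 0"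
  using future by (auto simp: future_cone_def light_cone_def)

lemma speed_pos: "u \<in> I \<Longrightarrow> v u > 0"
  using curve by (auto simp: spacelike_curve_def speed_def)

lemma X_deriv: "u \<in> I \<Longrightarrow> (X has_vector_derivative v u *\<^sub>R T u) (at u within I)"
  using smooth_on_has_vector_derivative[OF interval smooth] speed_pos[of u]
  by (simp add: tangent_def arc_deriv_def)

lemma tangent_unit:
  assumes "u \<in> I"
  shows "mink (T u) (T u) = 1"
proof -
  let ?D = "vector_derivative X (at u within I)"
  have "mink (T u) (T u) = mink ?D ?D / (v u)\<^sup>2"
    by (simp add: tangent_def arc_deriv_def mink.scaleR_left mink.scaleR_right power2_eq_square)
  moreover have "(v u)\<^sup>2 = mink ?D ?D"
    using speed_pos[OF assms] by (simp add: speed_def)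
  moreover have "(v u)\<^sup>2 \<noteq> 0"
    using speed_pos[OF assms] by simp
  ultimately show ?thesis
    by simp
qed

lemma tangent_orthogonal:
  assumes "u \<in> I"
  shows "mink (X u) (T u) = 0"
proof -
  have "mink (X u) (v u *\<^sub>R T u) + mink (v u *\<^sub>R T u) (X u) = 0"
    by (rule has_vector_derivative_unique_interval[OF interval assms
          mink.has_vector_derivative[OF X_deriv X_deriv] has_vector_derivative_const])
      (use assms null in auto)
  thus ?thesis
    using speed_pos[OF assms] by (simp add: mink.scaleR_right mink.scaleR_left mink_commute[of "T u"])
qed

text \<open>Existence and uniqueness of the null vector justify the definite description in
  \<open>associated\<close>.\<close>

lemma associated:
  assumes "u \<in> I"
  shows "Y u \<in> light_cone" "mink (Y u) (T u) = 0" "mink (X u) (Y u) = 1"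
proof -
  have "\<exists>!y. y \<in> light_cone \<and> mink y (T u) = 0 \<and> mink (X u) y = 1"
    using associated_vector_exists associated_vector_unique future[OF assms]
      tangent_orthogonal[OF assms] tangent_unit[OF assms] by (intro ex_ex1I) blast+
  from theI'[OF this]
  show "Y u \<in> light_cone" "mink (Y u) (T u) = 0" "mink (X u) (Y u) = 1"
    by (auto simp: associated_def)
qed

lemma associated_eqI:
  assumes "u \<in> I" "y \<in> light_cone" "mink y (T u) = 0" "mink (X u) y = 1"
  shows "Y u = y"
  using associated_vector_unique[OF future tangent_orthogonal tangent_unit assms(2-4) associated] assms
  by blast

lemma frame_expansion:
  assumes "u \<in> I"
  shows "w = mink w (Y u) *\<^sub>R X u + mink w (T u) *\<^sub>R T u + mink w (X u) *\<^sub>R Y u"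
  using associated[OF assms] null[OF assms] tangent_orthogonal[OF assms] tangent_unit[OF assms]
  by (intro null_frame_expansion) (auto simp: light_cone_def)

text \<open>The point is differentiability: \<open>T\<close> is the velocity divided by a positive
  square root. Only then does \<open>arc_deriv\<close>, built on \<open>vector_derivative\<close>,
  hold an actual derivative.\<close>

lemma T_deriv:
  assumes "u \<in> I"
  shows "(T has_vector_derivative v u *\<^sub>R arc_deriv I X T u) (at u within I)"
proof -
  obtain F where F: "F 0 = X" "\<And>n u. u \<in> I \<Longrightarrow> (F n has_vector_derivative F (Suc n) u) (at u within I)"
    using smooth_on_derivatives[OF smooth] by metis
  have D: "vector_derivative X (at w within I) = F 1 w" if "w \<in> I" for w
    using vector_derivative_within[OF interval_at_within_neq_bot[OF interval that] F(2)[OF that, of 0]]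
    by (simp add: F(1))
  have pos: "mink (F 1 u) (F 1 u) > 0"
    using curve assms D by (simp add: spacelike_curve_def)
  have "((\<lambda>u. mink (F 1 u) (F 1 u)) has_real_derivative 2 * mink (F 1 u) (F 2 u)) (at u within I)"
    using mink.has_vector_derivative[OF F(2)[OF assms, of 1] F(2)[OF assms, of 1]]
    by (simp add: has_real_derivative_iff_has_vector_derivative mink_commute[of "F (Suc (Suc 0)) u"] numeral_2_eq_2)
  hence "\<exists>c. ((\<lambda>u. 1 / sqrt (mink (F 1 u) (F 1 u))) has_real_derivative c) (at u within I)"
    using pos by (auto intro!: derivative_eq_intros exI)
  then obtain c where c: "((\<lambda>u. 1 / sqrt (mink (F 1 u) (F 1 u))) has_real_derivative c) (at u within I)"
    by blast
  obtain d where d: "((\<lambda>u. (1 / sqrt (mink (F 1 u) (F 1 u))) *\<^sub>R F 1 u) has_vector_derivative d) (at u within I)"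
    using has_vector_derivative_scaleR[OF c F(2)[OF assms, of 1]] by blast
  have "(T has_vector_derivative d) (at u within I)"
    by (rule has_vector_derivative_transform[OF assms _ d])
      (simp add: tangent_def arc_deriv_def speed_def D)
  moreover from this have "vector_derivative T (at u within I) = d"
    by (rule vector_derivative_within[OF interval_at_within_neq_bot[OF interval assms]])
  ultimately show ?thesis
    using speed_pos[OF assms] by (simp add: arc_deriv_def)
qed

lemma curvature_eqI:
  assumes "u \<in> I" "arc_deriv I X T u = c *\<^sub>R X u - Y u"
  shows "k u = c"
proof -
  have "X u \<noteq> 0"
    using future[OF assms(1)] by (auto simp: future_cone_def)
  thus ?thesis
    using assms(2) by (auto simp: curvature_def)
qed

text \<open>Differentiating \<open>mink T T = 1\<close> and \<open>mink X T = 0\<close> shows that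
  the frame coefficients at \<open>T\<close> and \<open>Y\<close> are \<open>0\<close> and
  \<open>-1\<close>. The remaining coefficient, at \<open>X\<close>, is the curvature.\<close>

lemma frenet:
  assumes "u \<in> I"
  shows "arc_deriv I X T u = k u *\<^sub>R X u - Y u"
proof -
  let ?A = "arc_deriv I X T u"
  have "mink (T u) (v u *\<^sub>R ?A) + mink (v u *\<^sub>R ?A) (T u) = 0"
    by (rule has_vector_derivative_unique_interval[OF interval assms
          mink.has_vector_derivative[OF T_deriv T_deriv] has_vector_derivative_const])
      (use assms tangent_unit in auto)
  hence 1: "mink ?A (T u) = 0"
    using speed_pos[OF assms] by (simp add: mink.scaleR_right mink.scaleR_left mink_commute[of "T u"])
  have "mink (X u) (v u *\<^sub>R ?A) + mink (v u *\<^sub>R T u) (T u) = 0"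
    by (rule has_vector_derivative_unique_interval[OF interval assms
          mink.has_vector_derivative[OF X_deriv T_deriv] has_vector_derivative_const])
      (use assms tangent_orthogonal in auto)
  hence "v u * (mink ?A (X u) + 1) = 0"
    using tangent_unit[OF assms]
    by (simp add: mink.scaleR_right mink.scaleR_left mink_commute[of "X u"] algebra_simps)
  hence 2: "mink ?A (X u) = -1"
    using speed_pos[OF assms] by simp
  have "?A = mink ?A (Y u) *\<^sub>R X u - Y u"
    using frame_expansion[OF assms, of ?A] 1 2 by simp
  with curvature_eqI[OF assms this] show ?thesis
    by simp
qed

section \<open>Scaling of the frame and the curvature under homotheties\<close>

lemma scaled_vector_derivative:
  assumes "u \<in> I"
  shows "vector_derivative (\<lambda>r. c *\<^sub>R X r) (at u within I) = c *\<^sub>R vector_derivative X (at u within I)"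
  by (rule vector_derivative_within[OF interval_at_within_neq_bot[OF interval assms]])
    (use has_vector_derivative_scaleR[OF DERIV_const smooth_on_has_vector_derivative[OF interval smooth assms]] in simp)

context
  fixes c :: real
  assumes c: "c > 0"
begin

lemma scaled_curve: "spacelike_curve I (\<lambda>r. c *\<^sub>R X r)"
proof -
  obtain F where F: "F 0 = X" "\<And>n u. u \<in> I \<Longrightarrow> (F n has_vector_derivative F (Suc n) u) (at u within I)"
    using smooth_on_derivatives[OF smooth] by metis
  have "smooth_on I (\<lambda>r. c *\<^sub>R X r)"
    unfolding smooth_on_def
    using F has_vector_derivative_scaleR[OF DERIV_const F(2)]
    by (intro exI[of _ "\<lambda>n r. c *\<^sub>R F n r"]) auto
  thus ?thesis
    using curve c
    by (auto simp: spacelike_curve_def scaled_vector_derivative future_cone_def light_cone_def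
        mink.scaleR_left mink.scaleR_right)
qed

lemma scaled_speed: "u \<in> I \<Longrightarrow> speed I (\<lambda>r. c *\<^sub>R X r) u = c * v u"
  using c by (simp add: speed_def scaled_vector_derivative mink.scaleR_left mink.scaleR_right
      real_sqrt_mult)

lemma scaled_tangent: "u \<in> I \<Longrightarrow> tangent I (\<lambda>r. c *\<^sub>R X r) u = T u"
  using c by (simp add: tangent_def arc_deriv_def scaled_speed scaled_vector_derivative)

lemma scaled_associated:
  assumes "u \<in> I"
  shows "associated I (\<lambda>r. c *\<^sub>R X r) u = (1 / c) *\<^sub>R Y u"
proof -
  interpret S: spacelike I "\<lambda>r. c *\<^sub>R X r"
    by unfold_locales (rule scaled_curve)
  show ?thesis
    using c associated[OF assms] assms
    by (intro S.associated_eqI)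
      (auto simp: scaled_tangent light_cone_def mink.scaleR_left mink.scaleR_right)
qed

text \<open>\<open>T\<close> is unchanged while arc length is multiplied by \<open>c\<close>, so the
  arc-length derivative of \<open>T\<close> is divided by \<open>c\<close>. A second factor
  \<open>1 / c\<close> comes from expressing \<open>X\<close> through
  \<open>c *\<^sub>R X\<close>.\<close>

lemma scaled_curvature:
  assumes "u \<in> I"
  shows "curvature I (\<lambda>r. c *\<^sub>R X r) u = k u / c\<^sup>2"
proof -
  interpret S: spacelike I "\<lambda>r. c *\<^sub>R X r"
    by unfold_locales (rule scaled_curve)
  have "(S.T has_vector_derivative v u *\<^sub>R arc_deriv I X T u) (at u within I)"
    by (rule has_vector_derivative_transform[OF assms _ T_deriv[OF assms]]) (simp add: scaled_tangent)
  hence "vector_derivative S.T (at u within I) = v u *\<^sub>R arc_deriv I X T u"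
    by (rule vector_derivative_within[OF interval_at_within_neq_bot[OF interval assms]])
  hence "arc_deriv I (\<lambda>r. c *\<^sub>R X r) S.T u = (1 / c) *\<^sub>R (k u *\<^sub>R X u - Y u)"
    using frenet[OF assms] speed_pos[OF assms] by (simp add: arc_deriv_def[of _ _ S.T] scaled_speed assms)
  also have "\<dots> = (k u / c\<^sup>2) *\<^sub>R (c *\<^sub>R X u) - S.Y u"
    using c by (simp add: scaled_associated assms power2_eq_square scaleR_diff_right)
  finally show ?thesis
    by (rule S.curvature_eqI[OF assms])
qed

end

end

section \<open>Closed curves\<close>

lemma vector_derivative_periodic:
  assumes "\<And>u. X (u + L) = X u" "\<And>u. (X has_vector_derivative D u) (at u)"
  shows "D (u + L) = D u"
proof -
  have "((X \<circ> (\<lambda>u. u + L)) has_vector_derivative 1 *\<^sub>R D (u + L)) (at u)"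
    by (rule vector_diff_chain_at) (auto intro!: derivative_eq_intros assms)
  hence "(X has_vector_derivative D (u + L)) (at u)"
    by (simp add: o_def assms(1))
  thus ?thesis
    using assms(2) vector_derivative_unique_at by blast
qed

text \<open>If the curvature were nonnegative, the time component of \<open>T' = k X - Y\<close> would be positive,
  so that of the periodic field \<open>T\<close> would be strictly increasing.\<close>

lemma closed_curve_negative_curvature:
  assumes "closed_spacelike_curve X"
  obtains u where "curvature UNIV X u < 0"
proof (rule ccontr)
  assume "\<not> thesis"
  hence k: "curvature UNIV X u \<ge> 0" for u
    using that[of u] by force
  obtain L where L: "L > 0" "\<And>u. X (u + L) = X u" and "spacelike_curve UNIV X"
    using assms by (auto simp: closed_spacelike_curve_def)
  then interpret spacelike UNIV X
    by unfold_locales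
  let ?D = "\<lambda>u. vector_derivative X (at u)"
  have D: "?D (u + L) = ?D u" for u
    by (rule vector_derivative_periodic[where X = X])
      (use L smooth_on_has_vector_derivative[OF interval smooth] in auto)
  have "T (0 + L) = T 0"
    unfolding tangent_def arc_deriv_def speed_def D ..
  moreover have "T 0 $ 1 < T L $ 1"
  proof (rule DERIV_pos_imp_increasing[OF L(1)])
    fix u
    have "(T has_vector_derivative v u *\<^sub>R (k u *\<^sub>R X u - Y u)) (at u)"
      using T_deriv[of u] frenet[of u] by simp
    hence "((\<lambda>u. T u $ 1) has_real_derivative v u * (k u * X u $ 1 - Y u $ 1)) (at u)"
      using bounded_linear.has_vector_derivative[OF bounded_linear_vec_nth[of 1]]
      by (fastforce simp: has_real_derivative_iff_has_vector_derivative)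
    \<comment> \<open>\<open>Y\<close> is past-directed because its product with the future-directed
      \<open>X\<close> is \<open>1\<close>.\<close>
    moreover have "X u $ 1 > 0" "Y u $ 1 < 0"
      using future[of u] mink_neg_of_future[OF future associated(1), of u u] associated(3)[of u]
      by (auto simp: future_cone_def)
    moreover from this k[of u] have "k u * X u $ 1 - Y u $ 1 > 0"
      by (smt (verit) mult_nonneg_nonneg)
    ultimately show "\<exists>y. ((\<lambda>u. T u $ 1) has_real_derivative y) (at u) \<and> y > 0"
      using speed_pos[of u] by auto
  qed
  ultimately show False
    by simp
qed

text \<open>A single point of negative curvature, supplied by closedness, fixes the sign of the
  constant.\<close>

lemma ellipse_of_constant_curvature:
  assumes "closed_spacelike_curve X" "\<And>u. curvature UNIV X u = c"
  shows "ellipse UNIV X"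
  using closed_curve_negative_curvature[OF assms(1)] assms
  by (auto simp: ellipse_def closed_spacelike_curve_def)

text \<open>\<open>A\<close> and \<open>B\<close> are position and velocity carried back to time
  \<open>0\<close> by the oscillator's flow, hence conserved. Solving for \<open>Z\<close> expresses
  it through \<open>cos (\<omega> * u)\<close> and \<open>sin (\<omega> * u)\<close>.\<close>

lemma harmonic_oscillator_periodic:
  fixes Z Z' :: "real \<Rightarrow> 'a::real_normed_vector"
  assumes "\<omega> > 0" "\<And>u. (Z has_vector_derivative Z' u) (at u)"
    and "\<And>u. (Z' has_vector_derivative - \<omega>\<^sup>2 *\<^sub>R Z u) (at u)"
  shows "Z (u + 2 * pi / \<omega>) = Z u"
proof -
  define A where "A u = cos (\<omega> * u) *\<^sub>R Z u - (sin (\<omega> * u) / \<omega>) *\<^sub>R Z' u" for u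
  define B where "B u = (\<omega> * sin (\<omega> * u)) *\<^sub>R Z u + cos (\<omega> * u) *\<^sub>R Z' u" for u
  have "(A has_vector_derivative 0) (at u)" "(B has_vector_derivative 0) (at u)" for u
    unfolding A_def B_def
    by (rule derivative_eq_intros has_vector_derivative_diff has_vector_derivative_add
        has_vector_derivative_scaleR assms refl | use assms(1) in
        \<open>simp add: power2_eq_square scaleR_diff_left[symmetric] algebra_simps\<close>)+
  then obtain a b where ab: "\<And>u. A u = a" "\<And>u. B u = b"
    using has_vector_derivative_zero_constant[of UNIV] by (metis UNIV_I convex_UNIV)
  have "Z u = cos (\<omega> * u) *\<^sub>R a + (sin (\<omega> * u) / \<omega>) *\<^sub>R b" for u
  proof -
    have "cos (\<omega> * u) *\<^sub>R A u + (sin (\<omega> * u) / \<omega>) *\<^sub>R B u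
        = (cos (\<omega> * u))\<^sup>2 *\<^sub>R Z u + (sin (\<omega> * u))\<^sup>2 *\<^sub>R Z u"
      using assms(1) by (simp add: A_def B_def power2_eq_square algebra_simps)
    also have "\<dots> = Z u"
      by (simp flip: scaleR_left_distrib)
    finally show ?thesis
      by (simp add: ab)
  qed
  moreover have "\<omega> * (u + 2 * pi / \<omega>) = \<omega> * u + 2 * pi" for u
    using assms(1) by (simp add: field_simps)
  ultimately show ?thesis
    by simp
qed

text \<open>For constant \<open>k\<close> the Frenet equations \<open>T' = k X - Y\<close>, \<open>Y' = - k T\<close> give \<open>X''' = 2 k X'\<close>,
  hence \<open>X''\<close> is harmonic and \<open>X'' - 2 k X\<close> constant.\<close>

lemma arc_length_ellipse_closed:
  assumes "ellipse UNIV X" "arc_length_parametrized UNIV X"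
  shows "closed_spacelike_curve X"
proof -
  interpret spacelike UNIV X
    using assms(1) by unfold_locales (simp add: ellipse_def)
  obtain c where c: "c < 0" "\<And>u. k u = c"
    using assms(1) by (auto simp: ellipse_def)
  obtain F where F: "F 0 = X" "\<And>n u. (F n has_vector_derivative F (Suc n) u) (at u)"
    using smooth_on_derivatives[OF smooth] by (metis UNIV_I)
  have v: "v u = 1" for u
    using assms(2) by (simp add: arc_length_parametrized_def)
  have T: "F 1 u = T u" for u
    using X_deriv[of u] F(2)[of 0 u] vector_derivative_unique_at[of X] by (simp add: F(1) v)
  hence F1: "F 1 = T"
    by auto
  have F2: "F 2 u = c *\<^sub>R X u - Y u" for u
    using T_deriv[of u] F(2)[of 1 u] vector_derivative_unique_at[of T] F1 frenet[of u]
    by (simp add: v c numeral_2_eq_2)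
  have Y: "Y = (\<lambda>u. c *\<^sub>R X u - F 2 u)"
    by (simp add: F2)
  have X': "(X has_vector_derivative T u) (at u)" for u
    using X_deriv[of u] by (simp add: v)
  have T': "(T has_vector_derivative c *\<^sub>R X u - Y u) (at u)" for u
    using F(2)[of 1 u] F2 F1 by (simp add: numeral_2_eq_2)
  define Y' where "Y' u = c *\<^sub>R T u - F 3 u" for u
  have Y': "(Y has_vector_derivative Y' u) (at u)" for u
    unfolding Y Y'_def using F(2)[of 2 u]
    by (auto intro!: derivative_eq_intros X' simp: numeral_3_eq_3 numeral_2_eq_2)
  have const: "a = 0" if "(f has_vector_derivative a) (at u)" "\<And>u. f u = d"
    for f :: "real \<Rightarrow> real" and a u d
    using has_vector_derivative_unique_interval[OF interval UNIV_I that(1) has_vector_derivative_const]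
      that(2) by blast
  have F3: "F 3 u = (2 * c) *\<^sub>R T u" for u
  proof -
    \<comment> \<open>The three constant products of \<open>Y\<close> with \<open>Y\<close>,
      \<open>X\<close> and \<open>T\<close> determine all frame coefficients of
      \<open>Y'\<close>.\<close>
    have "mink (Y u) (Y' u) + mink (Y' u) (Y u) = 0"
      by (rule const[OF mink.has_vector_derivative[OF Y' Y']])
        (use associated(1) in \<open>auto simp: light_cone_def\<close>)
    moreover have "mink (X u) (Y' u) + mink (T u) (Y u) = 0"
      by (rule const[OF mink.has_vector_derivative[OF X' Y']]) (use associated(3) in auto)
    moreover have "mink (Y u) (c *\<^sub>R X u - Y u) + mink (Y' u) (T u) = 0"
      by (rule const[OF mink.has_vector_derivative[OF Y' T']]) (use associated(2) in auto)
    ultimately have "mink (Y' u) (Y u) = 0" "mink (Y' u) (X u) = 0" "mink (Y' u) (T u) = - c"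
      using associated[of u]
      by (simp_all add: mink_commute[of "Y u" "Y' u"] mink_commute[of "Y u" "X u"]
          mink_commute[of "Y' u" "X u"] mink_commute[of "T u" "Y u"]
          mink.diff_right mink.scaleR_right light_cone_def)
    hence "Y' u = - c *\<^sub>R T u"
      using frame_expansion[of u "Y' u"] by simp
    hence "F 3 u = c *\<^sub>R T u + c *\<^sub>R T u"
      by (simp add: Y'_def algebra_simps)
    thus ?thesis
      by (simp flip: scaleR_left_distrib)
  qed
  \<comment> \<open>The period for the frequency \<open>\<omega>\<close> with
    \<open>\<omega>\<^sup>2 = - 2 * c\<close>, since the second derivative of \<open>F 2\<close> is
    \<open>2 * c\<close> times \<open>F 2\<close>.\<close>
  define L where "L = 2 * pi / sqrt (- 2 * c)"
  have "F 2 (u + L) = F 2 u" for u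
    unfolding L_def
  proof (rule harmonic_oscillator_periodic[where Z' = "F 3"])
    show "(F 2 has_vector_derivative F 3 u) (at u)" for u
      using F(2)[of 2 u] by (simp add: numeral_3_eq_3 numeral_2_eq_2)
    have "(T has_vector_derivative F 2 u) (at u)" for u
      using T' F2 by simp
    thus "(F 3 has_vector_derivative - (sqrt (- 2 * c))\<^sup>2 *\<^sub>R F 2 u) (at u)" for u
      unfolding F3[abs_def] using c(1) by (auto intro!: derivative_eq_intros)
  qed (use c in simp)
  moreover obtain C where "\<And>u. F 2 u - (2 * c) *\<^sub>R X u = C"
  proof -
    have "((\<lambda>u. F 2 u - (2 * c) *\<^sub>R X u) has_vector_derivative 0) (at u)" for u
      using F(2)[of 2 u] F3[of u]
      by (auto intro!: derivative_eq_intros X' simp: numeral_3_eq_3 numeral_2_eq_2)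
    thus ?thesis
      using has_vector_derivative_zero_constant[of UNIV "\<lambda>u. F 2 u - (2 * c) *\<^sub>R X u"] that
      by (metis UNIV_I convex_UNIV)
  qed
  \<comment> \<open>The constant \<open>C\<close> cancels, so the period of \<open>F 2\<close>
    passes to \<open>X\<close>.\<close>
  ultimately have "(2 * c) *\<^sub>R X (u + L) = (2 * c) *\<^sub>R X u" for u
    by (metis diff_left_imp_eq)
  hence "X (u + L) = X u" for u
    using c(1) by simp
  moreover have "L > 0"
    using c(1) by (simp add: L_def)
  ultimately show ?thesis
    using curve by (auto simp: closed_spacelike_curve_def)
qed

section \<open>Homothetic solutions\<close>

lemma interval_lessThan: "interval {..<a}"
proof -
  have "a - 1 \<in> {..<a}"
    by simp
  thus ?thesis
    by (auto simp: interval_def is_interval_io interior_open simp del: lessThan_iff)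
qed

lemma interval_nonempty: "interval I \<Longrightarrow> I \<noteq> {}"
  by (auto simp: interval_def)

context spacelike
begin

text \<open>The motion is along \<open>X\<close>, the associated vector is that of \<open>X\<close>
  divided by \<open>f t\<close>, and \<open>mink X Y = 1\<close>.\<close>

lemma homothetic_normal_speed:
  assumes "interval J" "t \<in> J" "(f has_vector_derivative d) (at t within J)" "f t > 0" "s \<in> I"
  shows "normal_speed I J (\<lambda>s t. f t *\<^sub>R X s) s t = d / f t"
proof -
  have "((\<lambda>r. f r *\<^sub>R X s) has_vector_derivative d *\<^sub>R X s) (at t within J)"
    using has_vector_derivative_scaleR[OF _ has_vector_derivative_const] assms(3)
    by (fastforce simp: has_real_derivative_iff_has_vector_derivative)
  hence "vector_derivative (\<lambda>r. f r *\<^sub>R X s) (at t within J) = d *\<^sub>R X s"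
    by (rule vector_derivative_within[OF interval_at_within_neq_bot[OF assms(1,2)]])
  thus ?thesis
    using associated(3)[OF assms(5)]
    by (simp add: normal_speed_def scaled_associated[OF assms(4,5)] mink.scaleR_left mink.scaleR_right)
qed

text \<open>The variables separate, so every mixed derivative is a derivative of \<open>f\<close>
  times a derivative of \<open>X\<close>.\<close>

lemma homothetic_family:
  assumes "interval J" "0 \<in> J" "smooth_on J f" "\<And>t. t \<in> J \<Longrightarrow> f t > 0"
  shows "spacelike_family I J (\<lambda>s t. f t *\<^sub>R X s)"
proof -
  obtain F where F: "F 0 = X" "\<And>n u. u \<in> I \<Longrightarrow> (F n has_vector_derivative F (Suc n) u) (at u within I)"
    using smooth_on_derivatives[OF smooth] by metis
  obtain G where G: "G 0 = f" "\<And>n t. t \<in> J \<Longrightarrow> (G n has_vector_derivative G (Suc n) t) (at t within J)"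
    using smooth_on_derivatives[OF assms(3)] by metis
  have "smooth_family I J (\<lambda>s t. f t *\<^sub>R X s)"
    unfolding smooth_family_def
  proof (rule exI[of _ "\<lambda>m n s t. G n t *\<^sub>R F m s"], intro conjI allI ballI)
    fix m n
    have "continuous_on I (F m)" "continuous_on J (G n)"
      using continuous_on_vector_derivative F(2) G(2) by blast+
    thus "continuous_on (I \<times> J) (\<lambda>(s, t). G n t *\<^sub>R F m s)"
      unfolding split_def
      by (intro continuous_on_scaleR continuous_on_compose2[of J "G n" _ snd]
          continuous_on_compose2[of I "F m" _ fst] continuous_on_fst continuous_on_snd continuous_on_id) auto
    fix s t assume s: "s \<in> I" and t: "t \<in> J"
    show "((\<lambda>u. G n t *\<^sub>R F m u) has_vector_derivative G n t *\<^sub>R F (Suc m) s) (at s within I)"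
      using has_vector_derivative_scaleR[OF DERIV_const F(2)[OF s]] by simp
    show "((\<lambda>u. G n u *\<^sub>R F m s) has_vector_derivative G (Suc n) t *\<^sub>R F m s) (at t within J)"
      using has_vector_derivative_scaleR[OF _ has_vector_derivative_const] G(2)[OF t]
      by (fastforce simp: has_real_derivative_iff_has_vector_derivative)
  qed (use F(1) G(1) in auto)
  thus ?thesis
    using assms scaled_curve by (auto simp: spacelike_family_def)
qed

end

text \<open>For constant curvature \<open>c\<close> both flows reduce to an equation of this kind for the homothety
  factor: \<open>f' = c / f\<close>, that is \<open>(f\<^sup>2)' = 2 c\<close>, for the CF, and \<open>f' = - f\<^sup>3 / c\<close>, that is
  \<open>(1 / f\<^sup>2)' = 2 / c\<close>, for the ICF.\<close>

definition scaling_solution :: "real \<Rightarrow> real \<Rightarrow> real set \<Rightarrow> (real \<Rightarrow> real) \<Rightarrow> bool" where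
  "scaling_solution b p J f \<longleftrightarrow> interval J \<and> 0 \<in> J \<and> smooth_on J f \<and> (\<forall>t\<in>J. f t > 0) \<and> f 0 = 1 \<and>
     (\<forall>t\<in>J. (f has_vector_derivative b * p * f t powr (1 - 1 / p)) (at t within J))"

text \<open>The equation says that \<open>f t powr (1 / p)\<close> has constant derivative
  \<open>b\<close>, and its value at \<open>0\<close> is \<open>1\<close>. As a power of a positive
  number it stays positive.\<close>

lemma scaling_solution_unique:
  assumes "scaling_solution b p J f" "p \<noteq> 0" "t \<in> J"
  shows "1 + b * t > 0" "f t = (1 + b * t) powr p"
proof -
  have J: "interval J" "0 \<in> J" and pos: "\<And>t. t \<in> J \<Longrightarrow> f t > 0" and f0: "f 0 = 1"
    and d: "\<And>t. t \<in> J \<Longrightarrow> (f has_real_derivative b * p * f t powr (1 - 1 / p)) (at t within J)"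
    using assms(1) by (auto simp: scaling_solution_def has_real_derivative_iff_has_vector_derivative)
  have deriv: "((\<lambda>t. f t powr (1 / p) - b * t) has_real_derivative 0) (at t within J)" if t: "t \<in> J" for t
  proof -
    have "((\<lambda>t. f t powr (1 / p)) has_real_derivative
        (1 / p * f t powr (1 / p - 1)) * (b * p * f t powr (1 - 1 / p))) (at t within J)"
      by (rule DERIV_chain2[OF has_real_derivative_powr[OF pos[OF t]] d[OF t]])
    also have "(1 / p * f t powr (1 / p - 1)) * (b * p * f t powr (1 - 1 / p))
        = b * (f t powr (1 / p - 1) * f t powr (1 - 1 / p))"
      using assms(2) by simp
    also have "\<dots> = b"
      using pos[OF t] by (simp flip: powr_add)
    finally have "((\<lambda>t. f t powr (1 / p)) has_real_derivative b) (at t within J)" .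
    from DERIV_diff[OF this DERIV_cmult_Id[of b]] show ?thesis
      by simp
  qed
  have "convex J"
    using J by (simp add: interval_def is_interval_convex)
  from has_field_derivative_zero_constant[OF this deriv]
  obtain C where C: "\<And>t. t \<in> J \<Longrightarrow> f t powr (1 / p) - b * t = C"
    by blast
  have eq: "f t powr (1 / p) = 1 + b * t"
    using C[OF assms(3)] C[OF J(2)] f0 by simp
  thus "1 + b * t > 0"
    using pos[OF assms(3)] by (metis less_irrefl powr_gt_zero)
  have "(f t powr (1 / p)) powr p = f t"
    using pos[OF assms(3)] assms(2) by (simp add: powr_powr)
  thus "f t = (1 + b * t) powr p"
    by (simp add: eq)
qed

text \<open>The half-line is where \<open>1 + b * t\<close> is positive.\<close>

lemma scaling_solution_exists:
  assumes "b < 0" "p \<noteq> 0"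
  shows "scaling_solution b p {..<- 1 / b} (\<lambda>t. (1 + b * t) powr p)"
proof -
  let ?J = "{..<- 1 / b}"
  \<comment> \<open>The \<open>n\<close>-th derivative in closed form, with a falling factorial of
    \<open>p\<close>.\<close>
  define F where "F n t = (\<Prod>i<n. p - real i) * b ^ n * (1 + b * t) powr (p - real n)" for n t
  have pos: "1 + b * t > 0" if "t \<in> ?J" for t
    using that assms(1) by (simp add: field_simps)
  have F: "(F n has_vector_derivative F (Suc n) t) (at t within ?J)" if "t \<in> ?J" for n t
  proof -
    have "((\<lambda>t. (1 + b * t) powr (p - real n)) has_real_derivative
        ((p - real n) * (1 + b * t) powr (p - real n - 1)) * b) (at t within ?J)"
      by (rule DERIV_chain2[where f = "\<lambda>z. z powr (p - real n)" and g = "\<lambda>t. 1 + b * t",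
            OF has_real_derivative_powr[OF pos[OF that]]])
        (auto intro!: derivative_eq_intros)
    from DERIV_cmult[OF this, of "(\<Prod>i<n. p - real i) * b ^ n"] show ?thesis
      by (simp add: F_def[abs_def] has_real_derivative_iff_has_vector_derivative algebra_simps)
  qed
  have F0: "F 0 = (\<lambda>t. (1 + b * t) powr p)"
    by (simp add: F_def[abs_def])
  have "smooth_on ?J (\<lambda>t. (1 + b * t) powr p)"
    unfolding smooth_on_def using F F0 by blast
  moreover have "F (Suc 0) t = b * p * ((1 + b * t) powr p) powr (1 - 1 / p)" if "t \<in> ?J" for t
    using assms(2) by (simp add: F_def powr_powr algebra_simps)
  hence "((\<lambda>t. (1 + b * t) powr p) has_vector_derivative
      b * p * ((1 + b * t) powr p) powr (1 - 1 / p)) (at t within ?J)" if "t \<in> ?J" for t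
    using F[OF that, of 0] that by (simp only: F0)
  moreover have "0 \<in> ?J"
    using assms(1) by (simp add: field_simps)
  ultimately show ?thesis
    using pos by (fastforce simp: scaling_solution_def interval_lessThan)
qed

context spacelike
begin

text \<open>Shared by both flows: \<open>P\<close> is the pointwise flow equation, and
  \<open>ODE\<close> reduces it at a fixed time to the equation for \<open>f\<close>.\<close>

lemma homothetic_iff_scaling_solution:
  assumes sol: "\<And>J Xh. sol I J X Xh \<longleftrightarrow> spacelike_family I J Xh \<and> (\<forall>s\<in>I. Xh s 0 = X s) \<and>
      (\<forall>s\<in>I. \<forall>t\<in>J. P J Xh s t)"
    and ODE: "\<And>t. interval J \<Longrightarrow> t \<in> J \<Longrightarrow> smooth_on J f \<Longrightarrow> f t > 0 \<Longrightarrow>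
      (\<forall>s\<in>I. P J (\<lambda>s t. f t *\<^sub>R X s) s t) \<longleftrightarrow>
      vector_derivative f (at t within J) = b * p * f t powr (1 - 1 / p)"
  shows "homothetic_solution sol I J X f \<longleftrightarrow> scaling_solution b p J f"
proof (cases "interval J \<and> 0 \<in> J \<and> smooth_on J f \<and> (\<forall>t\<in>J. f t > 0) \<and> f 0 = 1")
  case True
  hence "homothetic_solution sol I J X f \<longleftrightarrow> (\<forall>t\<in>J. \<forall>s\<in>I. P J (\<lambda>s t. f t *\<^sub>R X s) s t)"
    using homothetic_family by (auto simp: homothetic_solution_def sol)
  also have "\<dots> \<longleftrightarrow> (\<forall>t\<in>J. vector_derivative f (at t within J) = b * p * f t powr (1 - 1 / p))"
    by (intro ball_cong refl ODE) (use True in auto)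
  also have "\<dots> \<longleftrightarrow>
      (\<forall>t\<in>J. (f has_vector_derivative b * p * f t powr (1 - 1 / p)) (at t within J))"
  proof (rule ball_cong[OF refl])
    fix t assume t: "t \<in> J"
    show "vector_derivative f (at t within J) = b * p * f t powr (1 - 1 / p) \<longleftrightarrow>
        (f has_vector_derivative b * p * f t powr (1 - 1 / p)) (at t within J)"
      using True smooth_on_has_vector_derivative[of J f t] t
        vector_derivative_within[OF interval_at_within_neq_bot[of J t]] by metis
  qed
  finally show ?thesis
    using True by (simp add: scaling_solution_def)
next
  \<comment> \<open>Both sides imply these conditions on \<open>J\<close> and \<open>f\<close>, so
    both are false.\<close>
  case False
  thus ?thesis
    by (auto simp: homothetic_solution_def sol spacelike_family_def scaling_solution_def)
qed

lemma CF_homothetic_iff: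
  assumes c: "\<And>u. u \<in> I \<Longrightarrow> k u = c"
  shows "homothetic_solution CF_solution I J X f \<longleftrightarrow> scaling_solution (2 * c) (1 / 2) J f"
proof (rule homothetic_iff_scaling_solution[where sol = CF_solution, OF CF_solution_def])
  fix t assume J: "interval J" and t: "t \<in> J" and f: "smooth_on J f" "f t > 0"
  let ?d = "vector_derivative f (at t within J)"
  note d = smooth_on_has_vector_derivative[OF J f(1) t]
  have "(\<forall>s\<in>I. normal_speed I J (\<lambda>s t. f t *\<^sub>R X s) s t = curvature I (\<lambda>r. f t *\<^sub>R X r) s) \<longleftrightarrow>
      ?d / f t = c / (f t)\<^sup>2"
    using interval_nonempty[OF interval]
    by (auto simp: homothetic_normal_speed[OF J t d f(2)] scaled_curvature[OF f(2)] c)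
  \<comment> \<open>The exponent is \<open>-1\<close>, so the right-hand side is
    \<open>c / f t\<close>.\<close>
  also have "\<dots> \<longleftrightarrow> ?d = 2 * c * (1 / 2) * f t powr (1 - 1 / (1 / 2))"
    using f(2) by (simp add: powr_minus_divide field_simps power2_eq_square)
  finally show "(\<forall>s\<in>I. normal_speed I J (\<lambda>s t. f t *\<^sub>R X s) s t = curvature I (\<lambda>r. f t *\<^sub>R X r) s) \<longleftrightarrow>
      ?d = 2 * c * (1 / 2) * f t powr (1 - 1 / (1 / 2))" .
qed

lemma ICF_homothetic_iff:
  assumes c: "\<And>u. u \<in> I \<Longrightarrow> k u = c" "c \<noteq> 0"
  shows "homothetic_solution ICF_solution I J X f \<longleftrightarrow> scaling_solution (2 / c) (- 1 / 2) J f"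
proof (rule homothetic_iff_scaling_solution[where sol = ICF_solution, OF ICF_solution_def])
  fix t assume J: "interval J" and t: "t \<in> J" and f: "smooth_on J f" "f t > 0"
  let ?d = "vector_derivative f (at t within J)"
  note d = smooth_on_has_vector_derivative[OF J f(1) t]
  have "(\<forall>s\<in>I. curvature I (\<lambda>r. f t *\<^sub>R X r) s \<noteq> 0 \<and>
      normal_speed I J (\<lambda>s t. f t *\<^sub>R X s) s t = - 1 / curvature I (\<lambda>r. f t *\<^sub>R X r) s) \<longleftrightarrow>
      ?d / f t = - 1 / (c / (f t)\<^sup>2)"
    using interval_nonempty[OF interval] c(2) f(2)
    by (auto simp: homothetic_normal_speed[OF J t d f(2)] scaled_curvature[OF f(2)] c(1))
  \<comment> \<open>The exponent is \<open>3\<close>, so the right-hand side is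
    \<open>- (f t) ^ 3 / c\<close>.\<close>
  also have "\<dots> \<longleftrightarrow> ?d = 2 / c * (- 1 / 2) * f t powr (1 - 1 / (- 1 / 2))"
    using f(2) c(2) by (simp add: field_simps power2_eq_square power3_eq_cube)
  finally show "(\<forall>s\<in>I. curvature I (\<lambda>r. f t *\<^sub>R X r) s \<noteq> 0 \<and>
      normal_speed I J (\<lambda>s t. f t *\<^sub>R X s) s t = - 1 / curvature I (\<lambda>r. f t *\<^sub>R X r) s) \<longleftrightarrow>
      ?d = 2 / c * (- 1 / 2) * f t powr (1 - 1 / (- 1 / 2))" .
qed

lemma initial_homothetic_speed:
  assumes "spacelike_family I J (\<lambda>s t. f t *\<^sub>R X s)" "smooth_on J f" "f 0 = 1" "u \<in> I"
  shows "normal_speed I J (\<lambda>s t. f t *\<^sub>R X s) u 0 = vector_derivative f (at 0 within J)"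
  using assms homothetic_normal_speed[OF _ _ smooth_on_has_vector_derivative]
  by (simp add: spacelike_family_def)

text \<open>At time \<open>0\<close> the factor is \<open>1\<close>, so the flow equation equates
  the curvature of \<open>X\<close> with a number independent of \<open>u\<close>.\<close>

lemma CF_homothetic_curvature_constant:
  assumes "homothetic_solution CF_solution I J X f" "u \<in> I"
  shows "k u = vector_derivative f (at 0 within J)"
proof -
  have f: "smooth_on J f" "f 0 = 1" and fam: "spacelike_family I J (\<lambda>s t. f t *\<^sub>R X s)"
    using assms(1) by (simp_all add: homothetic_solution_def CF_solution_def)
  hence "normal_speed I J (\<lambda>s t. f t *\<^sub>R X s) u 0 = curvature I (\<lambda>r. f 0 *\<^sub>R X r) u"
    using assms unfolding homothetic_solution_def CF_solution_def spacelike_family_def by blast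
  thus ?thesis
    using initial_homothetic_speed[OF fam f assms(2)] f(2) by simp
qed

lemma ICF_homothetic_curvature_constant:
  assumes "homothetic_solution ICF_solution I J X f" "u \<in> I"
  shows "k u = - 1 / vector_derivative f (at 0 within J)"
proof -
  have f: "smooth_on J f" "f 0 = 1" and fam: "spacelike_family I J (\<lambda>s t. f t *\<^sub>R X s)"
    using assms(1) by (simp_all add: homothetic_solution_def ICF_solution_def)
  hence "normal_speed I J (\<lambda>s t. f t *\<^sub>R X s) u 0 = - 1 / curvature I (\<lambda>r. f 0 *\<^sub>R X r) u"
    using assms unfolding homothetic_solution_def ICF_solution_def spacelike_family_def by blast
  thus ?thesis
    using initial_homothetic_speed[OF fam f assms(2)] f(2) by simp
qed

end

section \<open>Maximal evolutions\<close>

lemma spacelike_family_tendsto: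
  assumes "spacelike_family I J Xh" "s \<in> I" "t \<in> J"
  shows "((\<lambda>r. Xh s r) \<longlongrightarrow> Xh s t) (at t within J)"
proof -
  have "smooth_family I J Xh"
    using assms(1) by (simp add: spacelike_family_def)
  then obtain F where F: "F 0 0 = Xh" and "\<forall>m n. continuous_on (I \<times> J) (\<lambda>(s, t). F m n s t) \<and>
      (\<forall>s\<in>I. \<forall>t\<in>J. ((\<lambda>u. F m n u t) has_vector_derivative F (Suc m) n s t) (at s within I) \<and>
        ((\<lambda>u. F m n s u) has_vector_derivative F m (Suc n) s t) (at t within J))"
    unfolding smooth_family_def by (elim exE conjE)
  hence "((\<lambda>u. F 0 0 s u) has_vector_derivative F 0 (Suc 0) s t) (at t within J)"
    using assms(2,3) by blast
  thus ?thesis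
    unfolding F using has_vector_derivative_continuous continuous_within by blast
qed

context
  fixes sol :: flow and I :: "real set" and X :: "real \<Rightarrow> real ^ 3" and b p :: real
  assumes X: "spacelike_curve I X" and b: "b < 0" and p: "p \<noteq> 0"
    and family: "\<And>J Xh. sol I J X Xh \<Longrightarrow> spacelike_family I J Xh"
    and homothetic_iff: "\<And>J f. homothetic_solution sol I J X f \<longleftrightarrow> scaling_solution b p J f"
begin

text \<open>The factor tends to \<open>0\<close> (for \<open>p > 0\<close>) or to infinity (for \<open>p < 0\<close>) at the end of the interval.
  Raising to the power \<open>1 / p\<close> treats both cases at once.\<close>

lemma maximal_evolution_exists:
  "maximal_homothetic_evolution sol I {..<- 1 / b} X (\<lambda>t. (1 + b * t) powr p)"
proof -
  define A where "A = - 1 / b"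
  have pos: "1 + b * t > 0" if "t < A" for t
    using that b by (simp add: A_def field_simps)
  have hom: "homothetic_solution sol I {..<A} X (\<lambda>t. (1 + b * t) powr p)"
    unfolding A_def using scaling_solution_exists[OF b p] by (simp add: homothetic_iff)
  have unique: "J = {..<A}"
    if sol: "sol I J X Xh" and sub: "{..<A} \<subseteq> J"
      and eq: "\<And>s t. s \<in> I \<Longrightarrow> t \<in> {..<A} \<Longrightarrow> Xh s t = (1 + b * t) powr p *\<^sub>R X s" for J Xh
  proof (rule ccontr)
    assume "J \<noteq> {..<A}"
    with sub obtain r where r: "r \<in> J" "r \<ge> A"
      by force
    have fam: "spacelike_family I J Xh"
      by (rule family[OF sol])
    hence "is_interval J"
      by (simp add: spacelike_family_def interval_def)
    moreover have "A - 1 \<in> J"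
      using sub by force
    \<comment> \<open>An interval containing \<open>A - 1\<close> and some \<open>r \<ge> A\<close>
      contains \<open>A\<close>.\<close>
    ultimately have A: "A \<in> J"
      using r mem_is_interval_1_I[of J "A - 1" r A] by simp
    obtain s where s: "s \<in> I"
      using X interval_nonempty by (auto simp: spacelike_curve_def)
    \<comment> \<open>Time components suffice: both are positive on the future cone, and before
      \<open>A\<close> their quotient is the homothety factor.\<close>
    define x y where "x = X s $ 1" and "y = Xh s A $ 1"
    have x: "x > 0" and y: "y > 0"
      using X fam s A by (auto simp: x_def y_def spacelike_family_def spacelike_curve_def future_cone_def)
    have ev: "eventually (\<lambda>t. t < A) (at_left A)"
      by (simp add: eventually_at_filter)
    have "((\<lambda>t. Xh s t $ 1 / x) \<longlongrightarrow> y / x) (at_left A)"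
      unfolding y_def
      by (intro tendsto_divide tendsto_const tendsto_vec_nth
          tendsto_within_subset[OF spacelike_family_tendsto[OF fam s A] sub]) (use x in simp)
    hence "((\<lambda>t. (1 + b * t) powr p) \<longlongrightarrow> y / x) (at_left A)"
      by (rule Lim_transform_eventually) (use ev in eventually_elim, use eq[OF s] x in \<open>simp add: x_def\<close>)
    hence "((\<lambda>t. ((1 + b * t) powr p) powr (1 / p)) \<longlongrightarrow> (y / x) powr (1 / p)) (at_left A)"
      by (rule tendsto_powr[OF _ tendsto_const]) (use x y in simp)
    hence "((\<lambda>t. 1 + b * t) \<longlongrightarrow> (y / x) powr (1 / p)) (at_left A)"
      by (rule Lim_transform_eventually)
        (use ev in eventually_elim, use pos p in \<open>simp add: powr_powr less_imp_le\<close>)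
    moreover have "((\<lambda>t. 1 + b * t) \<longlongrightarrow> 1 + b * A) (at_left A)"
      by (intro tendsto_intros)
    \<comment> \<open>The left-hand side is positive, but \<open>1 + b * t\<close> vanishes at
      \<open>A\<close>.\<close>
    ultimately have "(y / x) powr (1 / p) = 1 + b * A"
      by (rule tendsto_unique[rotated]) simp
    also have "\<dots> = 0"
      using b by (simp add: A_def)
    finally show False
      using x y by simp
  qed
  show ?thesis
    unfolding maximal_homothetic_evolution_def maximal_solution_def A_def[symmetric]
  proof (intro conjI allI impI)
    show "sol I {..<A} X (\<lambda>s t. (1 + b * t) powr p *\<^sub>R X s)"
      using hom by (simp add: homothetic_solution_def)
  qed (use hom unique in blast)+
qed

text \<open>The equation determines \<open>f\<close> on \<open>J\<close> and confines
  \<open>J\<close> to the half-line. The solution on the whole half-line extends it, so maximality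
  leaves no smaller \<open>J\<close>.\<close>

lemma maximal_evolution_unique:
  assumes "maximal_homothetic_evolution sol I J X f"
  shows "J = {..<- 1 / b}" "\<And>t. t \<in> J \<Longrightarrow> f t = (1 + b * t) powr p"
proof -
  have f: "scaling_solution b p J f"
    using assms by (simp add: maximal_homothetic_evolution_def homothetic_iff)
  note scaling_solution_unique[OF f p]
  thus eq: "f t = (1 + b * t) powr p" if "t \<in> J" for t
    using that by blast
  have "J \<subseteq> {..<- 1 / b}"
    using scaling_solution_unique(1)[OF f p] b by (force simp: field_simps)
  moreover have "sol I {..<- 1 / b} X (\<lambda>s t. (1 + b * t) powr p *\<^sub>R X s)"
    using maximal_evolution_exists by (simp add: maximal_homothetic_evolution_def homothetic_solution_def)
  moreover have maximal: "J' = J"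
    if "sol I J' X Xh'" "J \<subseteq> J'" "\<And>s t. s \<in> I \<Longrightarrow> t \<in> J \<Longrightarrow> Xh' s t = f t *\<^sub>R X s" for J' Xh'
    using assms that unfolding maximal_homothetic_evolution_def maximal_solution_def by blast
  ultimately have "{..<- 1 / b} = J"
    by (intro maximal[of _ "\<lambda>s t. (1 + b * t) powr p *\<^sub>R X s"]) (auto simp: eq)
  thus "J = {..<- 1 / b}" ..
qed

end

section \<open>Long-time behaviour of ellipses\<close>

lemma ellipse_CF_evolution:
  assumes "ellipse I X"
  shows "\<exists>J f. maximal_homothetic_evolution CF_solution I J X f"
    and "maximal_homothetic_evolution CF_solution I J X f \<Longrightarrow>
      ancient J \<and> collapses_into_0 I J (\<lambda>s t. f t *\<^sub>R X s)"
proof -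
  obtain c where X: "spacelike_curve I X" and c: "c < 0" "\<And>u. u \<in> I \<Longrightarrow> curvature I X u = c"
    using assms by (auto simp: ellipse_def)
  interpret spacelike I X
    by unfold_locales (rule X)
  have fam: "CF_solution I J X Xh \<Longrightarrow> spacelike_family I J Xh" for J Xh
    by (simp add: CF_solution_def)
  have b: "2 * c < 0" "1 / 2 \<noteq> (0 :: real)"
    using c(1) by auto
  note ctxt = X b fam CF_homothetic_iff[OF c(2)]
  show "\<exists>J f. maximal_homothetic_evolution CF_solution I J X f"
    using maximal_evolution_exists[OF ctxt] by blast
  assume "maximal_homothetic_evolution CF_solution I J X f"
  note max = maximal_evolution_unique[OF ctxt this]
  define A where "A = - 1 / (2 * c)"
  have J: "J = {..<A}" and f: "\<And>t. t \<in> J \<Longrightarrow> f t = sqrt (1 + 2 * c * t)"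
    using max c(1) by (auto simp: A_def powr_half_sqrt field_simps)
  \<comment> \<open>The square root is continuous up to \<open>A\<close>, where its argument is
    \<open>0\<close>.\<close>
  have "((\<lambda>t. sqrt (1 + 2 * c * t) *\<^sub>R X s) \<longlongrightarrow> sqrt (1 + 2 * c * A) *\<^sub>R X s) (at A within J)" for s
    by (intro tendsto_intros)
  hence lim: "((\<lambda>t. sqrt (1 + 2 * c * t) *\<^sub>R X s) \<longlongrightarrow> 0) (at A within J)" for s
    using c(1) by (simp add: A_def)
  have "((\<lambda>t. f t *\<^sub>R X s) \<longlongrightarrow> 0) (at A within J)" for s
    by (rule Lim_transform_eventually[OF lim[of s]]) (auto simp: f eventually_at_filter)
  thus "ancient J \<and> collapses_into_0 I J (\<lambda>s t. f t *\<^sub>R X s)"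
    by (auto simp: ancient_def collapses_into_0_def J)
qed

lemma ellipse_ICF_evolution:
  assumes "ellipse I X"
  shows "\<exists>J f. maximal_homothetic_evolution ICF_solution I J X f"
    and "maximal_homothetic_evolution ICF_solution I J X f \<Longrightarrow>
      ancient J \<and> evolves_from_0 I (\<lambda>s t. f t *\<^sub>R X s)"
proof -
  obtain c where X: "spacelike_curve I X" and c: "c < 0" "\<And>u. u \<in> I \<Longrightarrow> curvature I X u = c"
    using assms by (auto simp: ellipse_def)
  interpret spacelike I X
    by unfold_locales (rule X)
  have fam: "ICF_solution I J X Xh \<Longrightarrow> spacelike_family I J Xh" for J Xh
    by (simp add: ICF_solution_def)
  have b: "2 / c < 0" "- 1 / 2 \<noteq> (0 :: real)" and "c \<noteq> 0"
    using c(1) by (auto simp: divide_neg_pos divide_pos_neg)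
  note ctxt = X b fam ICF_homothetic_iff[OF c(2) this(3)]
  show "\<exists>J f. maximal_homothetic_evolution ICF_solution I J X f"
    using maximal_evolution_exists[OF ctxt] by blast
  assume "maximal_homothetic_evolution ICF_solution I J X f"
  note max = maximal_evolution_unique[OF ctxt this]
  \<comment> \<open>The growth is shown for the time-reversed factor and then mirrored to
    \<open>at_bot\<close>; the negative exponent turns it into decay.\<close>
  have "LIM t at_top. - (2 / c) * t :> at_top"
    by (rule filterlim_tendsto_pos_mult_at_top[OF tendsto_const _ filterlim_ident]) (use b(1) in simp)
  hence "LIM t at_top. 1 + - (2 / c) * t :> at_top"
    by (rule filterlim_tendsto_add_at_top[OF tendsto_const])
  hence "LIM t at_bot. 1 + 2 / c * t :> at_top"
    by (simp add: filterlim_at_bot_mirror)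
  hence "((\<lambda>t. (1 + 2 / c * t) powr (- 1 / 2)) \<longlongrightarrow> 0) at_bot"
    by (intro tendsto_neg_powr) auto
  from tendsto_scaleR[OF this tendsto_const]
  have lim: "((\<lambda>t. (1 + 2 / c * t) powr (- 1 / 2) *\<^sub>R X s) \<longlongrightarrow> 0) at_bot" for s
    by simp
  have "eventually (\<lambda>t. t < - 1 / (2 / c)) at_bot"
    by (rule eventually_gt_at_bot)
  hence ev: "eventually (\<lambda>t. (1 + 2 / c * t) powr (- 1 / 2) = f t) at_bot"
    by eventually_elim (use max in auto)
  have "((\<lambda>t. f t *\<^sub>R X s) \<longlongrightarrow> 0) at_bot" for s
    by (rule Lim_transform_eventually[OF lim[of s]]) (use ev in eventually_elim, simp)
  thus "ancient J \<and> evolves_from_0 I (\<lambda>s t. f t *\<^sub>R X s)"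
    using max by (auto simp: ancient_def evolves_from_0_def)
qed

text \<open>A homothetic evolution forces constant curvature, and closedness makes it negative;
  conversely every ellipse has a maximal homothetic evolution.\<close>

lemma closed_homothetic_iff_ellipse:
  assumes "closed_spacelike_curve X"
  shows "evolves_by_homotheties CF_solution UNIV X \<longleftrightarrow> ellipse UNIV X"
    and "evolves_by_homotheties ICF_solution UNIV X \<longleftrightarrow> ellipse UNIV X"
proof -
  interpret spacelike UNIV X
    using assms by unfold_locales (simp add: closed_spacelike_curve_def)
  show "evolves_by_homotheties CF_solution UNIV X \<longleftrightarrow> ellipse UNIV X"
    using CF_homothetic_curvature_constant ellipse_of_constant_curvature[OF assms]
      ellipse_CF_evolution(1)[of UNIV X]
    unfolding evolves_by_homotheties_def maximal_homothetic_evolution_def by blast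
  show "evolves_by_homotheties ICF_solution UNIV X \<longleftrightarrow> ellipse UNIV X"
    using ICF_homothetic_curvature_constant ellipse_of_constant_curvature[OF assms]
      ellipse_ICF_evolution(1)[of UNIV X]
    unfolding evolves_by_homotheties_def maximal_homothetic_evolution_def by blast
qed

text \<open>Periodicity depends on the parameter, so closedness of an ellipse is asserted for arc
  length.\<close>

theorem corollary1p4:
  shows "(\<forall>X. closed_spacelike_curve X \<longrightarrow>
            (evolves_by_homotheties CF_solution UNIV X \<longleftrightarrow> ellipse UNIV X) \<and>
            (evolves_by_homotheties ICF_solution UNIV X \<longleftrightarrow> ellipse UNIV X))
       \<and> (\<forall>X. ellipse UNIV X \<and> arc_length_parametrized UNIV X \<longrightarrow> closed_spacelike_curve X)
       \<and> (\<forall>X. ellipse UNIV X \<longrightarrow>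
            (\<exists>J f. maximal_homothetic_evolution CF_solution UNIV J X f) \<and>
            (\<forall>J f. maximal_homothetic_evolution CF_solution UNIV J X f \<longrightarrow>
               ancient J \<and> collapses_into_0 UNIV J (\<lambda>s t. f t *\<^sub>R X s)))
       \<and> (\<forall>X. ellipse UNIV X \<longrightarrow>
            (\<exists>J f. maximal_homothetic_evolution ICF_solution UNIV J X f) \<and>
            (\<forall>J f. maximal_homothetic_evolution ICF_solution UNIV J X f \<longrightarrow>
               ancient J \<and> evolves_from_0 UNIV (\<lambda>s t. f t *\<^sub>R X s)))"
  using closed_homothetic_iff_ellipse arc_length_ellipse_closed ellipse_CF_evolution
    ellipse_ICF_evolution
  by simp

end
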